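(* Let $R$ be a local ring, and let $I\subset J$ be two ideals of $R$ for which $I^{\mathrm{sat}}=J^{\mathrm{sat}}$. Then $R$ is weakly reduced at $J$ if and only if $R$ is weakly reduced at $I$.
   Context: Local rings are Noetherian. For an ideal $K$ of a local ring $(R,\mathfrak m)$, the saturation of $K$ is $K^{\mathrm{sat}}=\bigcup_{i\ge 1}(K:_R\mathfrak m^i)$. With $N$ the nilradical of $R$, $R$ is said to be weakly reduced at an ideal $K$ if $K^{\mathrm{sat}}+N=(K+N)^{\mathrm{sat}}$. *)

theory Defs
  imports "HOL-Algebra.Algebra"
begin

locale noetherian_local_ring = cring R + noetherian_ring R
  for R (structure) +
  fixes \<mm>
  assumes maximalideal_iff: "maximalideal M R \<longleftrightarrow> M = \<mm>"

definition nilradical :: "('a, 'b) ring_scheme \<Rightarrow> 'a set"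
  where "nilradical R = {x \<in> carrier R. \<exists>n::nat. x [^]\<^bsub>R\<^esub> n = \<zero>\<^bsub>R\<^esub>}"

definition colon_ideal :: "('a, 'b) ring_scheme \<Rightarrow> 'a set \<Rightarrow> 'a set \<Rightarrow> 'a set"
  where "colon_ideal R K L = {x \<in> carrier R. \<forall>y\<in>L. x \<otimes>\<^bsub>R\<^esub> y \<in> K}"

(* Multiplication in ideals_set R is the product of ideals (not the set of products of
   elements), so the power below is the i-th power of \<mm> as an ideal. *)
definition saturation :: "('a, 'b) ring_scheme \<Rightarrow> 'a set \<Rightarrow> 'a set \<Rightarrow> 'a set"
  where "saturation R \<mm> K = (\<Union>i\<in>{1::nat..}. colon_ideal R K (\<mm> [^]\<^bsub>ideals_set R\<^esub> i))"

definition weakly_reduced_at :: "('a, 'b) ring_scheme \<Rightarrow> 'a set \<Rightarrow> 'a set \<Rightarrow> bool"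
  where "weakly_reduced_at R \<mm> K \<longleftrightarrow>
    saturation R \<mm> K <+>\<^bsub>R\<^esub> nilradical R = saturation R \<mm> (K <+>\<^bsub>R\<^esub> nilradical R)"

end

theory Submission
  imports Defs
begin

text \<open>
  With \<open>N\<close> the nilradical, the left-hand sides of the two conditions agree by the hypothesis on the
  saturations, so everything rests on \<open>(I + N)\<^bsup>sat\<^esup> = (J + N)\<^bsup>sat\<^esup>\<close>.

  Saturation with respect to an ideal \<open>\<aa>\<close> is a closure operator on the ideals of a Noetherian
  ring. Only its idempotence needs finiteness: the ideals \<open>(K : \<aa>\<^sup>i)\<close> ascend, so their union is
  already attained at a single exponent \<open>i\<close> (lemma \<open>saturation_attained\<close>), and then
  \<open>x \<aa>\<^sup>j \<subseteq> (K : \<aa>\<^sup>i)\<close> gives \<open>x \<aa>\<^bsup>j+i\<^esup> \<subseteq> K\<close>. Consequently an ideal squeezed between \<open>K\<close> and its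
  saturation has the same saturation as \<open>K\<close> (lemma \<open>saturation_eq_if_between\<close>). This applies to
  \<open>I + N \<subseteq> J + N\<close>, because \<open>J \<subseteq> J\<^bsup>sat\<^esup> = I\<^bsup>sat\<^esup> \<subseteq> (I + N)\<^bsup>sat\<^esup>\<close> and \<open>N \<subseteq> (I + N)\<^bsup>sat\<^esup>\<close>, where
  \<open>(I + N)\<^bsup>sat\<^esup>\<close> is an ideal.
\<close>

text \<open>
  For \<open>a = \<one>\<close> this says that sums of nilpotents are nilpotent. The multiplier \<open>a\<close> replaces the
  binomial theorem: the induction on \<open>m + n\<close> splits \<open>(x \<oplus> y) \<otimes> a\<close> into \<open>x \<otimes> a\<close>, killed by
  one power of \<open>x\<close> less, and \<open>y \<otimes> a\<close>, killed by one power of \<open>y\<close> less.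
\<close>

lemma (in cring) pow_add_annihilates:
  assumes "x \<in> carrier R" "y \<in> carrier R" "a \<in> carrier R"
    and "x [^] (m::nat) \<otimes> a = \<zero>" "y [^] (n::nat) \<otimes> a = \<zero>"
  shows "(x \<oplus> y) [^] (m + n) \<otimes> a = \<zero>"
  using assms
proof (induction "m + n" arbitrary: m n a)
  case 0
  then show ?case by simp
next
  case (Suc k)
  note xy = Suc.prems(1,2) and a = Suc.prems(3)
  show ?case
  proof (cases "m = 0 \<or> n = 0")
    case True
    with Suc.prems have "a = \<zero>" by auto
    with xy show ?thesis by simp
  next
    case False
    then obtain m' n' where m: "m = Suc m'" and n: "n = Suc n'"
      by (metis not0_implies_Suc)
    have yxa: "y [^] n \<otimes> (x \<otimes> a) = \<zero>" and xya: "x [^] m \<otimes> (y \<otimes> a) = \<zero>"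
      using Suc.prems by (metis m_lcomm nat_pow_closed r_null)+
    have "x [^] m' \<otimes> (x \<otimes> a) = \<zero>"
      using Suc.prems(4) xy a by (simp add: m m_assoc)
    then have 1: "(x \<oplus> y) [^] k \<otimes> (x \<otimes> a) = \<zero>"
      using Suc.hyps(1)[of m' n "x \<otimes> a"] Suc.hyps(2) m xy a yxa by simp
    have "y [^] n' \<otimes> (y \<otimes> a) = \<zero>"
      using Suc.prems(5) xy a by (simp add: n m_assoc)
    then have 2: "(x \<oplus> y) [^] k \<otimes> (y \<otimes> a) = \<zero>"
      using Suc.hyps(1)[of m n' "y \<otimes> a"] Suc.hyps(2) n xy a xya by simp
    have "(x \<oplus> y) [^] (m + n) \<otimes> a = (x \<oplus> y) [^] k \<otimes> ((x \<oplus> y) \<otimes> a)"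
      using xy a by (simp add: Suc.hyps(2)[symmetric] m_assoc)
    also have "\<dots> = (x \<oplus> y) [^] k \<otimes> (x \<otimes> a) \<oplus> (x \<oplus> y) [^] k \<otimes> (y \<otimes> a)"
      using xy a by (simp add: l_distr r_distr)
    finally show ?thesis using 1 2 by simp
  qed
qed

lemma (in cring) ideal_if_add_mult_closed:
  assumes "S \<subseteq> carrier R" "\<zero> \<in> S"
    and "\<And>x y. x \<in> S \<Longrightarrow> y \<in> S \<Longrightarrow> x \<oplus> y \<in> S"
    and mult: "\<And>x r. x \<in> S \<Longrightarrow> r \<in> carrier R \<Longrightarrow> r \<otimes> x \<in> S"
  shows "ideal S R"
proof (rule idealI[OF ring_axioms])
  have "\<ominus> x \<in> S" if "x \<in> S" for x
    using mult[OF that, of "\<ominus> \<one>"] that assms(1) by (auto simp: l_minus)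
  then show "subgroup S (add_monoid R)"
    using assms by (intro add.subgroupI) (auto simp: a_inv_def)
next
  fix a x assume "a \<in> S" "x \<in> carrier R"
  then show "x \<otimes> a \<in> S" "a \<otimes> x \<in> S"
    using mult assms(1) by (auto simp: m_comm subset_iff)
qed

lemma (in cring) ideal_nilradical: "ideal (nilradical R) R"
proof (rule ideal_if_add_mult_closed)
  show "nilradical R \<subseteq> carrier R" by (auto simp: nilradical_def)
  have "\<zero> [^] (1::nat) = \<zero>" by simp
  then show "\<zero> \<in> nilradical R" unfolding nilradical_def by blast
next
  fix x y assume "x \<in> nilradical R" "y \<in> nilradical R"
  then obtain m n :: nat where "x \<in> carrier R" "y \<in> carrier R" "x [^] m = \<zero>" "y [^] n = \<zero>"
    by (auto simp: nilradical_def)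
  then have "(x \<oplus> y) [^] (m + n) = \<zero>"
    using pow_add_annihilates[of x y \<one> m n] by simp
  then show "x \<oplus> y \<in> nilradical R"
    using \<open>x \<in> carrier R\<close> \<open>y \<in> carrier R\<close> by (auto simp: nilradical_def)
next
  fix x r assume "x \<in> nilradical R" "r \<in> carrier R"
  then show "r \<otimes> x \<in> nilradical R"
    by (auto simp: nilradical_def nat_pow_distrib) (metis nat_pow_closed r_null)
qed

lemma (in cring) ideal_colon_ideal:
  assumes "ideal K R" "L \<subseteq> carrier R"
  shows "ideal (colon_ideal R K L) R"
proof -
  interpret K: ideal K R by fact
  note L = subsetD[OF assms(2)]
  show ?thesis
  proof (rule ideal_if_add_mult_closed)
    show "colon_ideal R K L \<subseteq> carrier R"
      by (auto simp: colon_ideal_def)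
    show "\<zero> \<in> colon_ideal R K L"
      by (simp add: colon_ideal_def L)
  next
    fix x y assume "x \<in> colon_ideal R K L" "y \<in> colon_ideal R K L"
    then show "x \<oplus> y \<in> colon_ideal R K L"
      by (simp add: colon_ideal_def L l_distr)
  next
    fix x r assume "x \<in> colon_ideal R K L" "r \<in> carrier R"
    then show "r \<otimes> x \<in> colon_ideal R K L"
      by (simp add: colon_ideal_def L m_assoc K.I_l_closed)
  qed
qed

lemma colon_ideal_mono:
  assumes "K \<subseteq> K'" "L' \<subseteq> L"
  shows "colon_ideal R K L \<subseteq> colon_ideal R K' L'"
  using assms by (auto simp: colon_ideal_def)

text \<open>
  Elements of the product \<open>L \<cdot> M\<close> are sums of products, so the inclusion is by induction over
  their generation, the sums being absorbed by additive closure of \<open>K\<close>.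
\<close>

lemma (in cring) colon_ideal_colon_ideal_subset:
  assumes "ideal K R" "ideal L R" "ideal M R"
  shows "colon_ideal R (colon_ideal R K M) L \<subseteq> colon_ideal R K (L \<cdot> M)"
proof
  interpret K: ideal K R by fact
  fix x assume x: "x \<in> colon_ideal R (colon_ideal R K M) L"
  then have xR: "x \<in> carrier R" by (simp add: colon_ideal_def)
  have "x \<otimes> z \<in> K" if "z \<in> L \<cdot> M" for z
    using that
  proof induction
    case (prod l m)
    then have "x \<otimes> l \<otimes> m \<in> K" using x by (auto simp: colon_ideal_def)
    then show ?case
      using prod xR assms by (simp add: m_assoc ideal.Icarr)
  next
    case (sum s t)
    then have "s \<in> carrier R" "t \<in> carrier R"
      using ideal_prod_in_carrier[OF assms(2,3)] by auto
    with sum xR show ?case by (simp add: r_distr)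
  qed
  with xR show "x \<in> colon_ideal R K (L \<cdot> M)" by (simp add: colon_ideal_def)
qed

lemma (in cring) ideal_power_ideal:
  assumes "ideal \<aa> R"
  shows "ideal (\<aa> [^]\<^bsub>ideals_set R\<^esub> (i::nat)) R"
proof -
  interpret S: comm_monoid "ideals_set R" by (rule ideals_set_is_comm_monoid)
  show ?thesis
    using S.nat_pow_closed[of \<aa> i] assms by (simp add: ideals_set_def)
qed

lemma (in cring) power_ideal_in_carrier:
  assumes "ideal \<aa> R"
  shows "\<aa> [^]\<^bsub>ideals_set R\<^esub> (i::nat) \<subseteq> carrier R"
  using ideal.Icarr[OF ideal_power_ideal[OF assms]] by (rule subsetI)

lemma (in cring) power_ideal_add:
  assumes "ideal \<aa> R"
  shows "\<aa> [^]\<^bsub>ideals_set R\<^esub> (i + j::nat) = (\<aa> [^]\<^bsub>ideals_set R\<^esub> i) \<cdot> (\<aa> [^]\<^bsub>ideals_set R\<^esub> j)"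
proof -
  interpret S: comm_monoid "ideals_set R" by (rule ideals_set_is_comm_monoid)
  show ?thesis
    using S.nat_pow_mult[of \<aa> i j] assms by (simp add: ideals_set_def)
qed

lemma (in cring) power_ideal_antimono:
  assumes "ideal \<aa> R" "(i::nat) \<le> j"
  shows "\<aa> [^]\<^bsub>ideals_set R\<^esub> j \<subseteq> \<aa> [^]\<^bsub>ideals_set R\<^esub> i"
  using power_ideal_add[OF assms(1), of i "j - i"] assms(2)
    ideal_prod_inter[OF ideal_power_ideal ideal_power_ideal, OF assms(1,1), of i "j - i"]
  by auto

lemma saturation_mono:
  assumes "K \<subseteq> L"
  shows "saturation R \<aa> K \<subseteq> saturation R \<aa> L"
  unfolding saturation_def using colon_ideal_mono[OF assms order_refl] by blast

lemma (in cring) subset_saturation: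
  assumes "ideal \<aa> R" "ideal K R"
  shows "K \<subseteq> saturation R \<aa> K"
proof
  interpret K: ideal K R by fact
  fix x assume "x \<in> K"
  then have "x \<in> colon_ideal R K (\<aa> [^]\<^bsub>ideals_set R\<^esub> (1::nat))"
    using subsetD[OF power_ideal_in_carrier[OF assms(1), of 1]]
    by (simp add: colon_ideal_def K.I_r_closed del: nat_pow_Suc)
  then show "x \<in> saturation R \<aa> K" unfolding saturation_def by blast
qed

text \<open>
  The ideals \<open>(K : \<aa>\<^sup>i)\<close> form a chain, since the powers of \<open>\<aa>\<close> descend, and a nonempty chain of
  ideals in a Noetherian ring contains its union.
\<close>

lemma (in cring) saturation_attained:
  assumes "noetherian_ring R" "ideal \<aa> R" "ideal K R"
  obtains i :: nat where "1 \<le> i" "saturation R \<aa> K = colon_ideal R K (\<aa> [^]\<^bsub>ideals_set R\<^esub> i)"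
proof -
  interpret noetherian_ring R by fact
  define q where "q i = colon_ideal R K (\<aa> [^]\<^bsub>ideals_set R\<^esub> i)" for i :: nat
  have "ideal (q i) R" for i
    unfolding q_def by (intro ideal_colon_ideal power_ideal_in_carrier assms)
  moreover have "q i \<subseteq> q j" if "i \<le> j" for i j
    unfolding q_def by (intro colon_ideal_mono order_refl power_ideal_antimono assms that)
  then have "q i \<subseteq> q j \<or> q j \<subseteq> q i" for i j
    by (meson nat_le_linear)
  ultimately have "subset.chain {I. ideal I R} (q ` {1..})"
    unfolding subset_chain_def by blast
  then have "\<Union>(q ` {1..}) \<in> q ` {1..}"
    by (intro ideal_chain_is_trivial) simp_all
  then obtain i where "1 \<le> i" "\<Union>(q ` {1..}) = q i" by blast
  then show thesis
    using that[of i] unfolding saturation_def q_def by simp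
qed

lemma (in cring) ideal_saturation:
  assumes "noetherian_ring R" "ideal \<aa> R" "ideal K R"
  shows "ideal (saturation R \<aa> K) R"
proof -
  obtain i :: nat where "saturation R \<aa> K = colon_ideal R K (\<aa> [^]\<^bsub>ideals_set R\<^esub> i)"
    using saturation_attained[OF assms] .
  then show ?thesis
    using ideal_colon_ideal[OF assms(3) power_ideal_in_carrier[OF assms(2)]] by simp
qed

text \<open>
  The case where \<open>L\<close> is the saturation of \<open>K\<close> is idempotence. A product \<open>x \<aa>\<^sup>j \<subseteq> L\<close> may involve
  many elements of \<open>L\<close>; the uniform exponent \<open>i\<close> with \<open>L \<subseteq> (K : \<aa>\<^sup>i)\<close> moves them all into \<open>K\<close> at
  once.
\<close>

lemma (in cring) saturation_eq_if_between:
  assumes "noetherian_ring R" "ideal \<aa> R" "ideal K R"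
    and "K \<subseteq> L" "L \<subseteq> saturation R \<aa> K"
  shows "saturation R \<aa> L = saturation R \<aa> K"
proof (rule antisym)
  let ?P = "\<lambda>i::nat. \<aa> [^]\<^bsub>ideals_set R\<^esub> i"
  obtain i :: nat where i: "saturation R \<aa> K = colon_ideal R K (?P i)"
    using saturation_attained[OF assms(1-3)] .
  show "saturation R \<aa> L \<subseteq> saturation R \<aa> K"
  proof
    fix x assume "x \<in> saturation R \<aa> L"
    then obtain j :: nat where j: "1 \<le> j" "x \<in> colon_ideal R L (?P j)"
      by (auto simp: saturation_def)
    have "colon_ideal R L (?P j) \<subseteq> colon_ideal R (colon_ideal R K (?P i)) (?P j)"
      by (intro colon_ideal_mono order_refl) (use assms(5) i in simp)
    also have "\<dots> \<subseteq> colon_ideal R K (?P (j + i))"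
      unfolding power_ideal_add[OF assms(2)]
      by (intro colon_ideal_colon_ideal_subset ideal_power_ideal assms)
    finally have "x \<in> colon_ideal R K (?P (j + i))"
      using j(2) by (rule subsetD)
    moreover have "j + i \<in> {1..}" using j(1) by simp
    ultimately show "x \<in> saturation R \<aa> K"
      unfolding saturation_def by (rule UN_I[rotated])
  qed
qed (rule saturation_mono[OF assms(4)])

lemma (in cring) saturation_add_cong:
  assumes "noetherian_ring R" "ideal \<aa> R" "ideal I R" "ideal J R" "ideal N R"
    and "I \<subseteq> J" "saturation R \<aa> I = saturation R \<aa> J"
  shows "saturation R \<aa> (J <+>\<^bsub>R\<^esub> N) = saturation R \<aa> (I <+>\<^bsub>R\<^esub> N)"
proof (rule saturation_eq_if_between)
  have ideal_IN: "ideal (I <+>\<^bsub>R\<^esub> N) R"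
    using assms by (intro add_ideals)
  then show "ideal (I <+>\<^bsub>R\<^esub> N) R" .
  show "I <+>\<^bsub>R\<^esub> N \<subseteq> J <+>\<^bsub>R\<^esub> N"
    using assms(6) by (auto simp: set_add_def')
  have "I \<union> N \<subseteq> I <+>\<^bsub>R\<^esub> N"
    using union_genideal[OF assms(3,5)] genideal_self[of "I \<union> N"]
      ideal.Icarr[OF assms(3)] ideal.Icarr[OF assms(5)]
    by blast
  moreover have IN_sat: "I <+>\<^bsub>R\<^esub> N \<subseteq> saturation R \<aa> (I <+>\<^bsub>R\<^esub> N)"
    using subset_saturation[OF assms(2) ideal_IN] .
  moreover have "J \<subseteq> saturation R \<aa> I"
    using subset_saturation[OF assms(2,4)] assms(7) by simp
  ultimately have JN: "J \<subseteq> saturation R \<aa> (I <+>\<^bsub>R\<^esub> N)" "N \<subseteq> saturation R \<aa> (I <+>\<^bsub>R\<^esub> N)"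
    using saturation_mono[of I "I <+>\<^bsub>R\<^esub> N" R \<aa>] by auto
  interpret S: ideal "saturation R \<aa> (I <+>\<^bsub>R\<^esub> N)" R
    using assms ideal_IN by (intro ideal_saturation)
  show "J <+>\<^bsub>R\<^esub> N \<subseteq> saturation R \<aa> (I <+>\<^bsub>R\<^esub> N)"
  proof
    fix z assume "z \<in> J <+>\<^bsub>R\<^esub> N"
    then obtain x y where "x \<in> J" "y \<in> N" "z = x \<oplus> y"
      by (auto simp: set_add_def')
    then show "z \<in> saturation R \<aa> (I <+>\<^bsub>R\<^esub> N)"
      using JN S.a_closed by blast
  qed
qed (use assms in auto)

theorem proposition5p2:
  fixes R :: "('a, 'b) ring_scheme" and \<mm> I J :: "'a set"
  assumes "noetherian_local_ring R \<mm>"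
    and "ideal I R" and "ideal J R" and "I \<subseteq> J"
    and "saturation R \<mm> I = saturation R \<mm> J"
  shows "weakly_reduced_at R \<mm> J \<longleftrightarrow> weakly_reduced_at R \<mm> I"
proof -
  interpret noetherian_local_ring R \<mm> by fact
  have "ideal \<mm> R"
    using maximalideal_iff[of \<mm>] maximalideal.axioms(1) by blast
  then have "saturation R \<mm> (J <+>\<^bsub>R\<^esub> nilradical R) = saturation R \<mm> (I <+>\<^bsub>R\<^esub> nilradical R)"
    using saturation_add_cong noetherian_ring_axioms assms(2-5) ideal_nilradical by blast
  then show ?thesis
    using assms(5) by (simp add: weakly_reduced_at_def)
qed

end
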